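(* Let $\Gamma$ be a Kleinian group that contains the parabolic element $A=\begin{pmatrix}1&1\\0&1\end{pmatrix}$. Then $$1\le\widetilde{J}(\Gamma)\le\inf\left\{|c|^2: T=\begin{pmatrix}a&b\\c&d\end{pmatrix}\in\Gamma,\ c\ne0,\ \text{and }\langle A,T\rangle\text{ is non-elementary}\right\}.$$ If $\Gamma$ is non-elementary and can be generated by $A$ and another element, then $$1\le J(\Gamma)\le\inf\left\{|c|^2: T=\begin{pmatrix}a&b\\c&d\end{pmatrix}\in\Gamma,\ c\ne0,\ \text{and }\langle A,T\rangle=\Gamma\right\}.$$
   Context: A Kleinian group is a discrete subgroup of $\mathrm{PSL}_2(\mathbb{C})$; elements are written as $\mathrm{SL}_2(\mathbb{C})$ matrices up to sign. For $X,Y\in\mathrm{PSL}_2(\mathbb{C})$ put $J(X,Y)=|\operatorname{tr}^2X-4|+|\operatorname{tr}[X,Y]-2|$. For an arbitrary subgroup $\Gamma\le\mathrm{PSL}_2(\mathbb{C})$, the generalized Jørgensen number is $\widetilde{J}(\Gamma)=\inf\{J(X,Y):\langle X,Y\rangle\le\Gamma\text{ is discrete and non-elementary}\}$. For a non-elementary Kleinian group $\Gamma$ generated by two elements, $J(\Gamma)=\inf\{J(X,Y):\langle X,Y\rangle=\Gamma\}$. The infimum of the empty set is $+\infty$. *)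

theory Defs
  imports "HOL-Analysis.Analysis" "HOL-Algebra.Generated_Groups"
begin

definition mat2 :: "complex \<Rightarrow> complex \<Rightarrow> complex \<Rightarrow> complex \<Rightarrow> complex^2^2" where
  "mat2 a b c d = vector [vector [a, b], vector [c, d]]"

definition SL2 :: "(complex^2^2) monoid" where
  "SL2 = \<lparr>carrier = {M. det M = 1}, mult = (**), one = mat 1\<rparr>"

definition PSL2 :: "(complex^2^2) set monoid" where
  "PSL2 = SL2 Mod {mat 1, - mat 1}"

text \<open>The class of a matrix of determinant 1; it equals the pair of matrices \<open>{M, - M}\<close>.\<close>

definition psl :: "complex^2^2 \<Rightarrow> (complex^2^2) set" where
  "psl M = {mat 1, - mat 1} #>\<^bsub>SL2\<^esub> M"

lemma matrix_neg_left: "(- A) ** B = - (A ** B)" for A B :: "complex^2^2"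
  by (simp add: vec_eq_iff matrix_matrix_mult_def sum_negf)

lemma matrix_neg_right: "A ** (- B) = - (A ** B)" for A B :: "complex^2^2"
  by (simp add: vec_eq_iff matrix_matrix_mult_def sum_negf)

lemma psl_eq: "psl M = {M, - M}"
  by (auto simp: psl_def r_coset_def SL2_def matrix_neg_left)

lemma det_minus_2: "det (- M) = det M" for M :: "complex^2^2"
  by (simp add: det_2)

lemma carrier_PSL2: "carrier PSL2 = psl ` carrier SL2"
  by (auto simp: PSL2_def FactGroup_def RCOSETS_def psl_def)

text \<open>The quotient topology, where \<open>SL\<^sub>2(\<complex>)\<close> carries the topology of a subspace of the space of
  matrices. As the points of the quotient are cosets, \<open>\<Union>U\<close> is the preimage of \<open>U\<close>.\<close>

definition PSL2_topology :: "(complex^2^2) set topology" where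
  "PSL2_topology =
     topology (\<lambda>U. U \<subseteq> carrier PSL2 \<and> openin (top_of_set (carrier SL2)) (\<Union>U))"

lemma openin_PSL2:
  "openin PSL2_topology U \<longleftrightarrow> U \<subseteq> carrier PSL2 \<and> openin (top_of_set (carrier SL2)) (\<Union>U)"
proof -
  let ?P = "\<lambda>U. U \<subseteq> carrier PSL2 \<and> openin (top_of_set (carrier SL2)) (\<Union>U)"
  have cls: "X = {M, - M}" if "X \<in> carrier PSL2" "M \<in> X" for X M
    using that by (auto simp: carrier_PSL2 psl_eq)
  have int: "\<Union>(S \<inter> T) = \<Union>S \<inter> \<Union>T" if "S \<subseteq> carrier PSL2" "T \<subseteq> carrier PSL2" for S T
  proof
    show "\<Union>S \<inter> \<Union>T \<subseteq> \<Union>(S \<inter> T)"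
    proof
      fix M assume "M \<in> \<Union>S \<inter> \<Union>T"
      then obtain X Y where XY: "X \<in> S" "M \<in> X" "Y \<in> T" "M \<in> Y" by blast
      then have "X = {M, - M}" "Y = {M, - M}" using that cls by blast+
      then show "M \<in> \<Union>(S \<inter> T)" using XY by blast
    qed
  qed blast
  have un: "\<Union>(\<Union>K) = \<Union>(Union ` K)" for K :: "(complex^2^2) set set set"
    by blast
  have "istopology ?P"
    unfolding istopology_def
  proof (intro conjI allI impI)
    fix S T assume "?P S" "?P T"
    then show "S \<inter> T \<subseteq> carrier PSL2" by blast
    show "openin (top_of_set (carrier SL2)) (\<Union>(S \<inter> T))"
      using \<open>?P S\<close> \<open>?P T\<close> int[of S T] openin_Int by metis
  next
    fix K assume K: "\<forall>S\<in>K. ?P S"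
    then show "\<Union>K \<subseteq> carrier PSL2" by blast
    show "openin (top_of_set (carrier SL2)) (\<Union>(\<Union>K))"
      unfolding un by (rule openin_Union) (use K in blast)
  qed
  then show ?thesis
    unfolding PSL2_topology_def by (simp only: topology_inverse')
qed

definition discrete_in_PSL2 :: "(complex^2^2) set set \<Rightarrow> bool" where
  "discrete_in_PSL2 \<Gamma> \<longleftrightarrow> subtopology PSL2_topology \<Gamma> = discrete_topology \<Gamma>"

definition kleinian :: "(complex^2^2) set set \<Rightarrow> bool" where
  "kleinian \<Gamma> \<longleftrightarrow> subgroup \<Gamma> PSL2 \<and> discrete_in_PSL2 \<Gamma>"

text \<open>Hyperbolic 3-space together with its sphere at infinity, in the upper half-space model:
  \<open>Some (z, t)\<close> lies in hyperbolic space if \<open>t > 0\<close> and in \<open>\<complex>\<close> if \<open>t = 0\<close>,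
  and \<open>None\<close> is the point \<open>\<infinity>\<close>.\<close>

definition closed_H3 :: "(complex \<times> real) option set" where
  "closed_H3 = {None} \<union> {Some (z, t) | z t. t \<ge> 0}"

text \<open>The Poincare extension of the Moebius transformation \<open>z \<mapsto> (a z + b) / (c z + d)\<close>,
  to which the formula reduces for \<open>t = 0\<close>. On \<open>closed_H3\<close>, for a matrix of determinant 1, the
  denominator \<open>q\<close> vanishes only if \<open>t = 0\<close> and \<open>c z + d = 0\<close>.\<close>

fun poincare :: "complex^2^2 \<Rightarrow> (complex \<times> real) option \<Rightarrow> (complex \<times> real) option" where
  "poincare M None =
     (if M$2$1 = 0 then None else Some (M$1$1 / M$2$1, 0))"
| "poincare M (Some (z, t)) =
     (let a = M$1$1; b = M$1$2; c = M$2$1; d = M$2$2;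
          q = (cmod (c * z + d))\<^sup>2 + (cmod c)\<^sup>2 * t\<^sup>2
      in if q = 0 then None
         else Some (((a * z + b) * cnj (c * z + d) + a * cnj c * of_real (t\<^sup>2)) / of_real q, t / q))"

text \<open>Both matrices of a class act in the same way, so the orbit may be taken over all of them.\<close>

lemma poincare_minus: "poincare (- M) p = poincare M p"
proof (cases p)
  case (Some y)
  obtain z t where y: "y = (z, t)" by (cases y)
  have neg: "cmod (- (M$2$1 * z) - M$2$2) = cmod (M$2$1 * z + M$2$2)"
    using norm_minus_cancel[of "M$2$1 * z + M$2$2"] by simp
  have num: "(- (a * z) - b) * (- (cnj c * cnj z) - cnj d) = (a * z + b) * (cnj c * cnj z + cnj d)"
    for a b c d :: complex by (simp add: algebra_simps)
  show ?thesis
    by (simp add: Some y Let_def neg num)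
qed simp

definition psl_orbit :: "(complex^2^2) set set \<Rightarrow> (complex \<times> real) option \<Rightarrow> (complex \<times> real) option set" where
  "psl_orbit \<Gamma> p = {poincare M p | M. M \<in> \<Union>\<Gamma>}"

text \<open>Elementary in the sense of Beardon: some point of hyperbolic space or of its sphere at
  infinity has a finite orbit.\<close>

definition elementary :: "(complex^2^2) set set \<Rightarrow> bool" where
  "elementary \<Gamma> \<longleftrightarrow> (\<exists>p\<in>closed_H3. finite (psl_orbit \<Gamma> p))"

definition jorgensen_SL2 :: "complex^2^2 \<Rightarrow> complex^2^2 \<Rightarrow> real" where
  "jorgensen_SL2 M N =
     cmod ((trace M)\<^sup>2 - 4) + cmod (trace (M ** N ** matrix_inv M ** matrix_inv N) - 2)"

definition jorgensen :: "(complex^2^2) set \<Rightarrow> (complex^2^2) set \<Rightarrow> real" where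
  "jorgensen X Y = jorgensen_SL2 (SOME M. M \<in> X) (SOME N. N \<in> Y)"

lemma matrix_inv_uminus:
  fixes M :: "complex^2^2"
  assumes "det M = 1"
  shows "matrix_inv (- M) = - matrix_inv M"
proof -
  have inv: "P ** matrix_inv P = mat 1 \<and> matrix_inv P ** P = mat 1" if "det P = 1" for P :: "complex^2^2"
  proof -
    have "invertible P" using that by (simp add: invertible_det_nz)
    then show ?thesis unfolding invertible_def matrix_inv_def by (rule someI_ex)
  qed
  have "- matrix_inv M = (matrix_inv (- M) ** (- M)) ** (- matrix_inv M)"
    using inv[of "- M"] assms by (simp add: det_minus_2)
  also have "\<dots> = matrix_inv (- M) ** (M ** matrix_inv M)"
    by (simp add: matrix_mul_assoc matrix_neg_left matrix_neg_right)
  also have "\<dots> = matrix_inv (- M)"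
    using inv[OF assms] by simp
  finally show ?thesis by simp
qed

lemma jorgensen_psl:
  assumes "M \<in> carrier SL2" "N \<in> carrier SL2"
  shows "jorgensen (psl M) (psl N) = jorgensen_SL2 M N"
proof -
  have det: "det M = 1" "det N = 1" using assms by (simp_all add: SL2_def)
  have tr: "trace (- P) = - trace P" for P :: "complex^2^2"
    by (simp add: trace_def sum_negf)
  have inv: "jorgensen_SL2 P Q = jorgensen_SL2 M N" if "P \<in> {M, - M}" "Q \<in> {N, - N}" for P Q
    using that det
    by (auto simp: jorgensen_SL2_def matrix_inv_uminus matrix_neg_left matrix_neg_right tr)
  have some: "(SOME P. P \<in> psl K) \<in> {K, - K}" for K
    using someI[of "\<lambda>P. P \<in> psl K" K] by (simp add: psl_eq)
  show ?thesis
    unfolding jorgensen_def by (intro inv some)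
qed

text \<open>Infima are taken in the extended reals, where the infimum of the empty set is \<open>\<infinity>\<close>.\<close>

definition gen_jorgensen_number :: "(complex^2^2) set set \<Rightarrow> ereal" where
  "gen_jorgensen_number \<Gamma> =
     Inf {ereal (jorgensen X Y) | X Y. X \<in> carrier PSL2 \<and> Y \<in> carrier PSL2 \<and>
        generate PSL2 {X, Y} \<subseteq> \<Gamma> \<and> discrete_in_PSL2 (generate PSL2 {X, Y}) \<and>
        \<not> elementary (generate PSL2 {X, Y})}"

definition jorgensen_number :: "(complex^2^2) set set \<Rightarrow> ereal" where
  "jorgensen_number \<Gamma> =
     Inf {ereal (jorgensen X Y) | X Y. X \<in> carrier PSL2 \<and> Y \<in> carrier PSL2 \<and>
        generate PSL2 {X, Y} = \<Gamma>}"

end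

theory Submission
  imports Defs
begin

text \<open>
  The upper bounds come from pairs \<open>(A, T)\<close> with \<open>A\<close> the given parabolic element. Since \<open>A\<close> has
  trace 2 and the commutator of \<open>A\<close> with \<open>T\<close> has trace \<open>2 + c\<^sup>2\<close>, the value of \<open>J\<close> at such a pair is
  \<open>\<bar>c\<bar>\<^sup>2\<close>, and a subgroup of a discrete group is discrete; hence each set on the right consists of
  values over which the corresponding Joergensen number is an infimum.

  The lower bounds are Joergensen's inequality (\<open>jorgensen_inequality\<close>): \<open>J(X, Y) < 1\<close> is impossible
  when \<open>X\<close> and \<open>Y\<close> generate a discrete, non-elementary group. The number \<open>J\<close>, discreteness and the
  existence of a finite invariant set of ideal points survive conjugation, so \<open>X\<close> may be taken
  diagonal, or with a single eigenvalue \<open>\<plusminus>1\<close>. Put \<open>g\<^sub>0 = Y\<close> and \<open>g\<^sub>n\<^sub>+\<^sub>1 = g\<^sub>n X g\<^sub>n\<^sup>-\<^sup>1\<close>. The condition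
  \<open>J < 1\<close> is exactly what makes this iteration contract.

  If \<open>X\<close> is parabolic, the lower left entries of the \<open>g\<^sub>n\<close> square at each step and \<open>g\<^sub>n\<close> converges to \<open>X\<close>.
  Discreteness makes the sequence eventually equal to \<open>X\<close> up to sign, which forces the lower left
  entry of \<open>Y\<close> to be zero, so \<open>\<infinity>\<close> is a common fixed point (\<open>jorgensen_parabolic\<close>).

  If \<open>X\<close> is diagonal with distinct eigenvalues, the products of the off-diagonal entries of \<open>g\<^sub>n\<close> tend to
  zero, and after conjugation by suitable powers of \<open>X\<close> both entries do. Discreteness now shows that
  some \<open>g\<^sub>2\<^sub>n\<close> is diagonal, and running the recursion backwards, \<open>Y\<close> fixes or swaps \<open>0\<close> and
  \<open>\<infinity>\<close> (\<open>jorgensen_diagonal\<close>). If \<open>X\<close> is central, any eigenvector of \<open>Y\<close> gives a common fixed point.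

  In each case the generators permute one or two ideal points, so these have finite orbits and
  the group is elementary (\<open>elementary_of_invariant_points\<close>).
\<close>

section \<open>Two by two matrices and the quotient group\<close>

lemma mat2_nth [simp]:
  "mat2 a b c d $ 1 $ 1 = a" "mat2 a b c d $ 1 $ 2 = b"
  "mat2 a b c d $ 2 $ 1 = c" "mat2 a b c d $ 2 $ 2 = d"
  by (simp_all add: mat2_def)

lemma mat2_eq_iff [simp]: "mat2 a b c d = mat2 a' b' c' d' \<longleftrightarrow> a = a' \<and> b = b' \<and> c = c' \<and> d = d'"
  by (metis mat2_nth)

lemma mat2_cases:
  fixes M :: "complex^2^2"
  obtains a b c d where "M = mat2 a b c d"
proof
  show "M = mat2 (M$1$1) (M$1$2) (M$2$1) (M$2$2)"
    by (simp add: vec_eq_iff forall_2)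
qed

lemma mat2_mult [simp]:
  "mat2 a b c d ** mat2 a' b' c' d' =
     mat2 (a*a' + b*c') (a*b' + b*d') (c*a' + d*c') (c*b' + d*d')"
  by (simp add: vec_eq_iff forall_2 matrix_matrix_mult_def sum_2)

lemma mat2_minus [simp]: "- mat2 a b c d = mat2 (- a) (- b) (- c) (- d)"
  by (simp add: vec_eq_iff forall_2)

lemma mat2_det [simp]: "det (mat2 a b c d) = a * d - b * c"
  by (simp add: det_2)

lemma mat2_trace [simp]: "trace (mat2 a b c d) = a + d"
  by (simp add: trace_def sum_2)

lemma mat2_one: "mat 1 = mat2 1 0 0 1"
  by (simp add: vec_eq_iff forall_2 mat_def)

lemma tendsto_mat2:
  assumes "(a \<longlongrightarrow> a') F" "(b \<longlongrightarrow> b') F" "(c \<longlongrightarrow> c') F" "(d \<longlongrightarrow> d') F"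
  shows "((\<lambda>n. mat2 (a n) (b n) (c n) (d n)) \<longlongrightarrow> mat2 a' b' c' d') F"
proof (intro vec_tendstoI)
  fix i j :: 2
  show "((\<lambda>n. mat2 (a n) (b n) (c n) (d n) $ i $ j) \<longlongrightarrow> mat2 a' b' c' d' $ i $ j) F"
    using exhaust_2[of i] exhaust_2[of j] assms by (elim disjE) simp_all
qed

lemma matrix_inv_cancel:
  fixes M :: "complex^2^2"
  assumes "det M = 1"
  shows "M ** matrix_inv M = mat 1" "matrix_inv M ** M = mat 1"
proof -
  have "invertible M" using assms by (simp add: invertible_det_nz)
  then have "M ** matrix_inv M = mat 1 \<and> matrix_inv M ** M = mat 1"
    unfolding invertible_def matrix_inv_def by (rule someI_ex)
  then show "M ** matrix_inv M = mat 1" "matrix_inv M ** M = mat 1" by auto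
qed

lemma matrix_inv_unique:
  fixes M N :: "complex^2^2"
  assumes "det M = 1" "M ** N = mat 1"
  shows "matrix_inv M = N"
  by (metis assms matrix_inv_cancel(2) matrix_mul_assoc matrix_mul_lid matrix_mul_rid)

lemma matrix_inv_mat2 [simp]:
  "a * d - b * c = 1 \<Longrightarrow> matrix_inv (mat2 a b c d) = mat2 d (- b) (- c) a"
  by (rule matrix_inv_unique) (simp_all add: mat2_one algebra_simps)

lemma det_matrix_inv:
  fixes M :: "complex^2^2"
  assumes "det M = 1" shows "det (matrix_inv M) = 1"
  using matrix_inv_cancel(1)[OF assms] assms by (metis det_I det_mul mult_1)

lemma group_SL2: "group SL2"
proof (rule groupI)
  fix x assume "x \<in> carrier SL2"
  then show "\<exists>y\<in>carrier SL2. y \<otimes>\<^bsub>SL2\<^esub> x = \<one>\<^bsub>SL2\<^esub>"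
    by (intro bexI[of _ "matrix_inv x"]) (auto simp: SL2_def det_matrix_inv matrix_inv_cancel)
qed (auto simp: SL2_def det_mul matrix_mul_assoc)

lemma normal_centre: "{mat 1, - mat 1} \<lhd> SL2"
proof (rule group.normal_invI[OF group_SL2])
  interpret group SL2 by (rule group_SL2)
  have m: "- mat 1 ** - mat 1 = (mat 1 :: complex^2^2)"
    by (simp add: mat2_one)
  show "subgroup {mat 1, - mat 1} SL2"
  proof
    fix x assume x: "x \<in> {mat 1, - mat 1 :: complex^2^2}"
    have "inv\<^bsub>SL2\<^esub> x = x"
      by (rule inv_equality) (use x m in \<open>auto simp: SL2_def det_minus_2\<close>)
    then show "inv\<^bsub>SL2\<^esub> x \<in> {mat 1, - mat 1}" using x by simp
  qed (auto simp: SL2_def det_minus_2 m)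
  fix x h assume "x \<in> carrier SL2" "h \<in> {mat 1, - mat 1 :: complex^2^2}"
  then show "x \<otimes>\<^bsub>SL2\<^esub> h \<otimes>\<^bsub>SL2\<^esub> inv\<^bsub>SL2\<^esub> x \<in> {mat 1, - mat 1}"
    using r_inv[of x] by (auto simp: SL2_def matrix_neg_left matrix_neg_right)
qed

lemma group_PSL2: "group PSL2"
  unfolding PSL2_def by (rule normal.factorgroup_is_group[OF normal_centre])

lemma psl_mult: "psl M \<otimes>\<^bsub>PSL2\<^esub> psl N = psl (M ** N)"
  by (auto simp: PSL2_def psl_eq set_mult_def SL2_def matrix_neg_left matrix_neg_right)

lemma psl_one: "\<one>\<^bsub>PSL2\<^esub> = psl (mat 1)"
  by (simp add: PSL2_def psl_eq FactGroup_def)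

lemma psl_in_carrier: "psl M \<in> carrier PSL2 \<longleftrightarrow> det M = 1"
proof
  assume "psl M \<in> carrier PSL2"
  then obtain N where "det N = 1" "M \<in> {N, - N}"
    by (auto simp: carrier_PSL2 SL2_def psl_eq)
  then show "det M = 1" by (auto simp: det_minus_2)
qed (simp add: carrier_PSL2 SL2_def)

lemma psl_cases:
  assumes "C \<in> carrier PSL2"
  obtains M where "det M = 1" "C = psl M"
  using assms by (auto simp: carrier_PSL2 SL2_def)

lemma class_of_member: "C \<in> carrier PSL2 \<Longrightarrow> M \<in> C \<Longrightarrow> C = psl M \<and> det M = 1"
  by (auto simp: carrier_PSL2 psl_eq SL2_def det_minus_2)

lemma psl_inv:
  assumes "det M = 1" shows "inv\<^bsub>PSL2\<^esub> (psl M) = psl (matrix_inv M)"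
  by (rule group.inv_equality[OF group_PSL2])
    (use assms in \<open>simp_all add: psl_mult psl_one psl_in_carrier det_matrix_inv matrix_inv_cancel\<close>)

section \<open>Discrete groups of matrices\<close>

text \<open>The only form in which discreteness is used: a sequence in the group that converges to an
  element of the group is eventually equal to it up to sign. The sign is there because the group
  is the preimage in \<open>SL\<^sub>2(\<complex>)\<close> of a subgroup of \<open>PSL\<^sub>2(\<complex>)\<close>.\<close>

definition discrete_matrix_group :: "(complex^2^2) set \<Rightarrow> bool" where
  "discrete_matrix_group S \<longleftrightarrow>
     (\<forall>M\<in>S. det M = 1 \<and> matrix_inv M \<in> S) \<and> (\<forall>M\<in>S. \<forall>N\<in>S. M ** N \<in> S) \<and>
     (\<forall>m L. (\<forall>n. m n \<in> S) \<longrightarrow> L \<in> S \<longrightarrow> m \<longlonglongrightarrow> L \<longrightarrow> (\<forall>\<^sub>F n in sequentially. m n \<in> {L, - L}))"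

lemma discrete_matrix_groupD:
  assumes "discrete_matrix_group S"
  shows "M \<in> S \<Longrightarrow> det M = 1" "M \<in> S \<Longrightarrow> matrix_inv M \<in> S"
    "M \<in> S \<Longrightarrow> N \<in> S \<Longrightarrow> M ** N \<in> S"
    "(\<And>n. m n \<in> S) \<Longrightarrow> L \<in> S \<Longrightarrow> m \<longlonglongrightarrow> L \<Longrightarrow> \<forall>\<^sub>F n in sequentially. m n \<in> {L, - L}"
  using assms unfolding discrete_matrix_group_def by blast+

text \<open>Some open set of classes meets \<open>G\<close> only in the class of \<open>L\<close>. Its preimage in \<open>SL\<^sub>2(\<complex>)\<close> is open,
  so it contains almost all terms of a sequence converging to \<open>L\<close>, and it meets \<open>\<Union>G\<close> only in
  \<open>L\<close> and \<open>- L\<close>.\<close>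

lemma discrete_matrix_group_Union:
  assumes "subgroup G PSL2" "discrete_in_PSL2 G"
  shows "discrete_matrix_group (\<Union>G)"
  unfolding discrete_matrix_group_def
proof (intro conjI ballI allI impI)
  have sub: "C \<in> carrier PSL2" if "C \<in> G" for C
    using assms(1) that by (rule subgroup.mem_carrier)
  have mem: "psl M \<in> G" "det M = 1" if "M \<in> \<Union>G" for M
    using that sub class_of_member by blast+
  show "det M = 1" if "M \<in> \<Union>G" for M using mem that by blast
  show "matrix_inv M \<in> \<Union>G" if "M \<in> \<Union>G" for M
    using subgroup.m_inv_closed[OF assms(1) mem(1)[OF that]] mem(2)[OF that]
    by (simp add: psl_inv) (metis UnionI insertI1 psl_eq)
  show "M ** N \<in> \<Union>G" if "M \<in> \<Union>G" "N \<in> \<Union>G" for M N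
    using subgroup.m_closed[OF assms(1) mem(1)[OF that(1)] mem(1)[OF that(2)]]
    by (simp add: psl_mult) (metis UnionI insertI1 psl_eq)
  fix m :: "nat \<Rightarrow> complex^2^2" and L
  assume m: "\<forall>n. m n \<in> \<Union>G" and L: "L \<in> \<Union>G" and lim: "m \<longlonglongrightarrow> L"
  have "openin (subtopology PSL2_topology G) {psl L}"
    using assms(2) mem(1)[OF L] by (simp add: discrete_in_PSL2_def)
  then obtain U where U: "openin PSL2_topology U" "{psl L} = U \<inter> G"
    by (auto simp: openin_subtopology)
  then obtain T where T: "open T" "\<Union>U = carrier SL2 \<inter> T"
    by (auto simp: openin_PSL2 openin_open)
  have "L \<in> T" using U(2) T(2) by (auto simp: psl_eq)
  then have "\<forall>\<^sub>F n in sequentially. m n \<in> T"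
    using lim T(1) by (rule topological_tendstoD[rotated 2])
  then show "\<forall>\<^sub>F n in sequentially. m n \<in> {L, - L}"
  proof (rule eventually_mono)
    fix n assume "m n \<in> T"
    then have "m n \<in> \<Union>U" using mem(2) m T(2) by (auto simp: SL2_def)
    then obtain D where D: "D \<in> U" "m n \<in> D" by blast
    then have "D \<in> carrier PSL2" using U(1) by (auto simp: openin_PSL2)
    then have "D = psl (m n)" using D(2) class_of_member by blast
    then have "D \<in> U \<inter> G" using D(1) mem(1) m by blast
    then show "m n \<in> {L, - L}" using U(2) D(2) by (auto simp: psl_eq)
  qed
qed

definition conjugate :: "complex^2^2 \<Rightarrow> complex^2^2 \<Rightarrow> complex^2^2" where
  "conjugate P M = matrix_inv P ** M ** P"

lemma conjugate_mult:
  assumes "det P = 1" shows "conjugate P (M ** N) = conjugate P M ** conjugate P N"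
proof -
  have "conjugate P M ** conjugate P N = matrix_inv P ** M ** (P ** matrix_inv P) ** N ** P"
    by (simp add: conjugate_def matrix_mul_assoc)
  then show ?thesis
    by (simp add: matrix_inv_cancel[OF assms] conjugate_def matrix_mul_assoc)
qed

lemma det_conjugate: "det P = 1 \<Longrightarrow> det (conjugate P M) = det M"
  by (simp add: conjugate_def det_mul det_matrix_inv)

lemma trace_conjugate: "det P = 1 \<Longrightarrow> trace (conjugate P M) = trace M"
  by (metis conjugate_def matrix_inv_cancel(1) matrix_mul_assoc matrix_mul_lid trace_mul_sym)

lemma conjugate_matrix_inv:
  assumes "det P = 1" "det M = 1"
  shows "conjugate P (matrix_inv M) = matrix_inv (conjugate P M)"
  by (rule matrix_inv_unique[symmetric])
    (use assms in \<open>simp_all add: det_conjugate flip: conjugate_mult\<close>,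
     simp add: matrix_inv_cancel conjugate_def)

lemma conjugate_cancel:
  assumes "det P = 1" shows "P ** conjugate P M = M ** P"
  by (simp add: conjugate_def matrix_mul_assoc matrix_inv_cancel[OF assms])

lemma conjugate_comp:
  assumes "det P = 1" "det Q = 1"
  shows "conjugate (P ** Q) M = conjugate Q (conjugate P M)"
proof -
  have "matrix_inv (P ** Q) = matrix_inv Q ** matrix_inv P"
  proof (rule matrix_inv_unique)
    have "P ** Q ** (matrix_inv Q ** matrix_inv P) = P ** (Q ** matrix_inv Q) ** matrix_inv P"
      by (simp add: matrix_mul_assoc)
    then show "P ** Q ** (matrix_inv Q ** matrix_inv P) = mat 1"
      using assms by (simp add: matrix_inv_cancel)
  qed (simp add: assms det_mul)
  then show ?thesis by (simp add: conjugate_def matrix_mul_assoc)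
qed

lemma tendsto_matrix_mult:
  fixes A B :: "'a \<Rightarrow> complex^2^2"
  assumes "(A \<longlongrightarrow> M) F" "(B \<longlongrightarrow> N) F"
  shows "((\<lambda>x. A x ** B x) \<longlongrightarrow> M ** N) F"
  unfolding matrix_matrix_mult_def
  by (intro vec_tendstoI) (auto intro!: tendsto_intros assms)

lemma discrete_matrix_group_conjugate:
  assumes S: "discrete_matrix_group S" and P: "det P = 1"
  shows "discrete_matrix_group (conjugate P ` S)"
  unfolding discrete_matrix_group_def
proof (intro conjI ballI allI impI)
  note D = discrete_matrix_groupD[OF S]
  show "det M = 1" if "M \<in> conjugate P ` S" for M
    using that D(1) by (auto simp: det_conjugate[OF P])
  show "matrix_inv M \<in> conjugate P ` S" if "M \<in> conjugate P ` S" for M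
    using that D(1,2) by (auto simp flip: conjugate_matrix_inv[OF P])
  show "M ** N \<in> conjugate P ` S" if "M \<in> conjugate P ` S" "N \<in> conjugate P ` S" for M N
    using that D(3) by (auto simp flip: conjugate_mult[OF P])
  fix m :: "nat \<Rightarrow> complex^2^2" and L
  assume m: "\<forall>n. m n \<in> conjugate P ` S" and L: "L \<in> conjugate P ` S" and lim: "m \<longlonglongrightarrow> L"
  have unconj: "P ** conjugate P M ** matrix_inv P = M" for M
  proof -
    have "P ** conjugate P M ** matrix_inv P = M ** (P ** matrix_inv P)"
      unfolding conjugate_cancel[OF P] by (simp add: matrix_mul_assoc)
    then show ?thesis by (simp add: matrix_inv_cancel[OF P])
  qed
  have conj: "conjugate P (P ** M ** matrix_inv P) = M" for M
  proof -
    have "conjugate P (P ** M ** matrix_inv P) = (matrix_inv P ** P) ** M ** (matrix_inv P ** P)"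
      unfolding conjugate_def by (simp add: matrix_mul_assoc)
    then show ?thesis by (simp add: matrix_inv_cancel[OF P])
  qed
  have "\<forall>\<^sub>F n in sequentially. P ** m n ** matrix_inv P \<in> {P ** L ** matrix_inv P, - (P ** L ** matrix_inv P)}"
  proof (rule D(4))
    show "P ** m n ** matrix_inv P \<in> S" for n using m[rule_format, of n] by (auto simp: unconj)
    show "P ** L ** matrix_inv P \<in> S" using L by (auto simp: unconj)
  qed (intro tendsto_matrix_mult tendsto_const lim)
  then show "\<forall>\<^sub>F n in sequentially. m n \<in> {L, - L}"
  proof (rule eventually_mono)
    fix n assume "P ** m n ** matrix_inv P \<in> {P ** L ** matrix_inv P, - (P ** L ** matrix_inv P)}"
    then have "conjugate P (P ** m n ** matrix_inv P) \<in>
        {conjugate P (P ** L ** matrix_inv P), conjugate P (P ** (- L) ** matrix_inv P)}"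
      by (auto simp: matrix_neg_left matrix_neg_right)
    then show "m n \<in> {L, - L}" by (simp add: conj)
  qed
qed

lemma jorgensen_SL2_conjugate:
  assumes "det P = 1" "det M = 1" "det N = 1"
  shows "jorgensen_SL2 (conjugate P M) (conjugate P N) = jorgensen_SL2 M N"
  using assms by (simp add: jorgensen_SL2_def trace_conjugate
      flip: conjugate_mult conjugate_matrix_inv)

text \<open>The one trace computation, which serves the diagonal case (\<open>w = 0\<close>), the parabolic case
  (\<open>u = v\<close>), and the value \<open>\<bar>c\<bar>\<^sup>2\<close> in the upper bounds (\<open>u = v = w = 1\<close>).\<close>

lemma jorgensen_SL2_triangular:
  assumes "u * v = 1" "a * d - b * c = 1"
  shows "jorgensen_SL2 (mat2 u w 0 v) (mat2 a b c d) =
    cmod ((u - v)\<^sup>2) + cmod (w\<^sup>2 * c\<^sup>2 - (u - v) * (b * c * (u - v) - w * c * (a - d)))"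
proof -
  have "(u + v)\<^sup>2 - 4 = (u - v)\<^sup>2 + 4 * (u * v - 1)"
    by (simp add: power2_eq_square algebra_simps)
  then have "(u + v)\<^sup>2 - 4 = (u - v)\<^sup>2" unfolding assms(1) by simp
  moreover have "trace (mat2 u w 0 v ** mat2 a b c d ** matrix_inv (mat2 u w 0 v) ** matrix_inv (mat2 a b c d)) - 2
     = w\<^sup>2 * c\<^sup>2 - (u - v) * (b * c * (u - v) - w * c * (a - d))"
  proof -
    have "trace (mat2 u w 0 v ** mat2 a b c d ** matrix_inv (mat2 u w 0 v) ** matrix_inv (mat2 a b c d))
       = trace (mat2 u w 0 v ** mat2 a b c d ** mat2 v (- w) 0 u ** mat2 d (- b) (- c) a)"
      using matrix_inv_mat2[of u v w 0] matrix_inv_mat2[OF assms(2)] assms(1) by simp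
    also have "\<dots> = 2 * (u * v) * (a * d - b * c) + w\<^sup>2 * c\<^sup>2
        - (u - v) * (b * c * (u - v) - w * c * (a - d))"
      by (simp add: power2_eq_square algebra_simps)
    finally show ?thesis unfolding assms by simp
  qed
  ultimately show ?thesis by (simp add: jorgensen_SL2_def)
qed

section \<open>Iterated conjugation\<close>

lemma tendsto_0_of_ratio:
  fixes x r :: "nat \<Rightarrow> complex"
  assumes step: "\<And>n. x (Suc n) = r n * x n" and r: "r \<longlonglongrightarrow> l" and l: "cmod l < 1"
  shows "x \<longlonglongrightarrow> 0"
proof -
  obtain q where q: "cmod l < q" "q < 1" using l dense by blast
  have "\<forall>\<^sub>F n in sequentially. cmod (r n) < q"
    using order_tendstoD(2)[OF tendsto_norm[OF r] q(1)] .
  then obtain N where N: "\<And>n. n \<ge> N \<Longrightarrow> cmod (r n) < q"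
    by (auto simp: eventually_sequentially)
  have "summable x"
  proof (rule summable_ratio_test[OF q(2)])
    fix n assume "N \<le> n"
    then show "cmod (x (Suc n)) \<le> q * cmod (x n)"
      unfolding step norm_mult using N[of n] by (intro mult_right_mono) auto
  qed
  then show ?thesis by (rule summable_LIMSEQ_zero)
qed

definition iterated_conjugate :: "complex^2^2 \<Rightarrow> complex^2^2 \<Rightarrow> nat \<Rightarrow> complex^2^2" where
  "iterated_conjugate f g n = ((\<lambda>h. h ** f ** matrix_inv h) ^^ n) g"

lemma iterated_conjugate_simps [simp]:
  "iterated_conjugate f g 0 = g"
  "iterated_conjugate f g (Suc n) =
     iterated_conjugate f g n ** f ** matrix_inv (iterated_conjugate f g n)"
  by (simp_all add: iterated_conjugate_def)

lemma iterated_conjugate_mem: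
  assumes "discrete_matrix_group S" "f \<in> S" "g \<in> S"
  shows "iterated_conjugate f g n \<in> S"
  by (induction n) (use assms discrete_matrix_groupD in auto)

text \<open>Conjugating \<open>f\<close> repeatedly gives matrices whose lower left entries satisfy
  \<open>w c\<^sub>n\<^sub>+\<^sub>1 = - (w c\<^sub>n)\<^sup>2\<close>. They tend to zero without ever vanishing if \<open>c \<noteq> 0\<close>, while the upper
  left entries stay bounded, so that the conjugates converge to \<open>f\<close> without reaching \<open>\<plusminus>f\<close>.\<close>

lemma jorgensen_parabolic:
  assumes S: "discrete_matrix_group S"
    and f: "mat2 u w 0 u \<in> S" and w: "w \<noteq> 0"
    and g: "mat2 a b c d \<in> S" and small: "cmod (w * c) < 1"
  shows "c = 0"
proof (rule ccontr)
  assume "c \<noteq> 0"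
  define G where "G = iterated_conjugate (mat2 u w 0 u) (mat2 a b c d)"
  define A where "A n = G n $ 1 $ 1" for n
  define B where "B n = G n $ 1 $ 2" for n
  define C where "C n = G n $ 2 $ 1" for n
  define D where "D n = G n $ 2 $ 2" for n
  have G_S: "G n \<in> S" for n
    unfolding G_def by (rule iterated_conjugate_mem[OF S f g])
  have Gn: "G n = mat2 (A n) (B n) (C n) (D n)" for n
    by (simp add: A_def B_def C_def D_def vec_eq_iff forall_2)
  have dt: "A n * D n - B n * C n = 1" for n
    using discrete_matrix_groupD(1)[OF S G_S[of n]] unfolding Gn by simp
  have uu: "u * u = 1" using discrete_matrix_groupD(1)[OF S f] by simp
  have G_Suc: "G (Suc n) = mat2 (A n) (B n) (C n) (D n) ** mat2 u w 0 u ** mat2 (D n) (- B n) (- C n) (A n)" for n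
    using matrix_inv_mat2[OF dt[of n]] Gn[of n] by (simp add: G_def)
  have "mat2 (A (Suc n)) (B (Suc n)) (C (Suc n)) (D (Suc n)) =
      mat2 (u * (A n * D n - B n * C n) - A n * (w * C n)) (w * (A n)\<^sup>2)
        (- (w * (C n)\<^sup>2)) (u * (A n * D n - B n * C n) + A n * (w * C n))" for n
    unfolding Gn[of "Suc n", symmetric] G_Suc by (simp add: algebra_simps power2_eq_square)
  then have rec: "A (Suc n) = u - A n * (w * C n)" "B (Suc n) = w * (A n)\<^sup>2"
      "C (Suc n) = - (w * (C n)\<^sup>2)" "D (Suc n) = u + A n * (w * C n)" for n
    by (simp_all add: dt)
  have C0: "C n \<noteq> 0" for n
    by (induction n) (use \<open>c \<noteq> 0\<close> w rec(3) in \<open>auto simp: C_def G_def\<close>)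
  define q where "q = cmod (w * c)"
  have q: "0 \<le> q" "q < 1" using small by (auto simp: q_def)
  have wC_pow: "cmod (w * C n) \<le> q ^ Suc n" for n
  proof (induction n)
    case 0 then show ?case by (simp add: q_def C_def G_def)
  next
    case (Suc n)
    have "q ^ Suc n \<le> q" using q power_le_one[of q n] by (simp add: mult_left_le)
    then have "cmod (w * C n) \<le> q" using Suc by linarith
    have "w * C (Suc n) = - (w * C n)\<^sup>2" by (simp add: rec power2_eq_square)
    then have "cmod (w * C (Suc n)) = cmod (w * C n) * cmod (w * C n)"
      by (simp add: norm_mult power2_eq_square)
    also have "\<dots> \<le> q * q ^ Suc n"
      using Suc \<open>cmod (w * C n) \<le> q\<close> q by (intro mult_mono) auto
    finally show ?case by simp
  qed
  have wC_le: "cmod (w * C n) \<le> q" for n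
    using wC_pow[of n] q power_le_one[of q n] mult_left_le[of "q ^ n" q] by simp
  have wC: "(\<lambda>n. w * C n) \<longlonglongrightarrow> 0"
  proof (rule Lim_null_comparison[OF always_eventually[OF allI[OF wC_pow]]])
    show "(\<lambda>n. q ^ Suc n) \<longlonglongrightarrow> 0"
      using q by (intro LIMSEQ_Suc LIMSEQ_power_zero) auto
  qed
  have "u = 1 \<or> u = - 1" using uu by (simp add: square_eq_1_iff)
  then have cu: "cmod u = 1" by auto
  \<comment> \<open>The bound is the fixed point of the majorant \<open>t \<mapsto> 1 + q t\<close>, enlarged to cover \<open>A 0 = a\<close>.\<close>
  have A_bd: "cmod (A n) \<le> 1 / (1 - q) + cmod a" for n
  proof (induction n)
    case 0 then show ?case using q by (simp add: A_def G_def)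
  next
    case (Suc n)
    have "cmod (A (Suc n)) \<le> 1 + cmod (A n) * cmod (w * C n)"
      unfolding rec using norm_triangle_ineq4[of u "A n * (w * C n)"] by (simp add: cu norm_mult)
    also have "\<dots> \<le> 1 + (1 / (1 - q) + cmod a) * q"
      using Suc wC_le[of n] by (intro add_left_mono mult_mono) (use q in auto)
    also have "\<dots> = 1 / (1 - q) + cmod a * q" using q by (simp add: field_simps)
    also have "\<dots> \<le> 1 / (1 - q) + cmod a" using q by (simp add: mult_left_le)
    finally show ?case .
  qed
  have AwC: "(\<lambda>n. A n * (w * C n)) \<longlonglongrightarrow> 0"
  proof (rule Lim_null_comparison)
    show "\<forall>\<^sub>F n in sequentially. cmod (A n * (w * C n)) \<le> (1 / (1 - q) + cmod a) * cmod (w * C n)"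
      using A_bd unfolding norm_mult[of "A _"] by (intro always_eventually allI mult_right_mono) auto
    show "(\<lambda>n. (1 / (1 - q) + cmod a) * cmod (w * C n)) \<longlonglongrightarrow> 0"
      using tendsto_mult[OF tendsto_const tendsto_norm[OF wC]] by simp
  qed
  have lim_A: "(\<lambda>n. A (Suc n)) \<longlonglongrightarrow> u"
    unfolding rec using tendsto_diff[OF tendsto_const AwC] by simp
  then have A_lim: "A \<longlonglongrightarrow> u" by (rule LIMSEQ_imp_Suc)
  have D_lim: "(\<lambda>n. D (Suc n)) \<longlonglongrightarrow> u"
    unfolding rec using tendsto_add[OF tendsto_const AwC] by simp
  have B_lim: "(\<lambda>n. B (Suc n)) \<longlonglongrightarrow> w"
    unfolding rec using tendsto_mult[OF tendsto_const tendsto_power[OF A_lim, of 2], of w] uu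
    by (simp add: power2_eq_square)
  have "(\<lambda>n. w * C n * (1 / w)) \<longlonglongrightarrow> 0 * (1 / w)"
    by (intro tendsto_mult wC tendsto_const)
  then have C_lim: "(\<lambda>n. C (Suc n)) \<longlonglongrightarrow> 0" using w by (intro LIMSEQ_Suc) simp
  have "(\<lambda>n. G (Suc n)) \<longlonglongrightarrow> mat2 u w 0 u"
    unfolding Gn by (intro tendsto_mat2 lim_A B_lim C_lim D_lim)
  then have "\<forall>\<^sub>F n in sequentially. G (Suc n) \<in> {mat2 u w 0 u, - mat2 u w 0 u}"
    by (intro discrete_matrix_groupD(4)[OF S] G_S f)
  then obtain n where "G (Suc n) \<in> {mat2 u w 0 u, - mat2 u w 0 u}"
    by (auto simp: eventually_sequentially)
  then have "C (Suc n) = 0" unfolding Gn by auto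
  then show False using C0 by blast
qed

text \<open>For the iterated conjugates \<open>g\<^sub>n\<close> the product \<open>p\<^sub>n = b\<^sub>n c\<^sub>n\<close> satisfies
  \<open>p\<^sub>n\<^sub>+\<^sub>1 = - p\<^sub>n (1 + p\<^sub>n) (u - v)\<^sup>2\<close>, a contraction to zero under the hypothesis, so the diagonal of
  \<open>g\<^sub>n\<close> converges to that of \<open>f\<close>. The entries \<open>b\<^sub>n\<close> and \<open>c\<^sub>n\<close> need not tend to zero one by one: their growth
  factors approach \<open>u (v - u)\<close> and \<open>v (u - v)\<close>, of which one can be large. But \<open>b\<^sub>n v\<^sup>n\<close> and
  \<open>c\<^sub>n u\<^sup>n\<close> do tend to zero, and for even indices \<open>2 n\<close> these are the entries of
  \<open>f\<^sup>-\<^sup>n g\<^sub>2\<^sub>n f\<^sup>n\<close>, a sequence in the group with limit \<open>f\<close>.\<close>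

lemma jorgensen_diagonal:
  assumes S: "discrete_matrix_group S"
    and f: "mat2 u 0 0 v \<in> S" and ne: "u \<noteq> v"
    and g: "mat2 a b c d \<in> S" and small: "cmod ((u - v)\<^sup>2) * (1 + cmod (b * c)) < 1"
  shows "b = 0 \<and> c = 0 \<or> a = 0 \<and> d = 0"
proof -
  define G where "G = iterated_conjugate (mat2 u 0 0 v) (mat2 a b c d)"
  define A where "A n = G n $ 1 $ 1" for n
  define B where "B n = G n $ 1 $ 2" for n
  define C where "C n = G n $ 2 $ 1" for n
  define D where "D n = G n $ 2 $ 2" for n
  define p where "p n = B n * C n" for n
  define q where "q = cmod ((u - v)\<^sup>2) * (1 + cmod (b * c))"
  have G_S: "G n \<in> S" for n
    unfolding G_def by (rule iterated_conjugate_mem[OF S f g])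
  have Gn: "G n = mat2 (A n) (B n) (C n) (D n)" for n
    by (simp add: A_def B_def C_def D_def vec_eq_iff forall_2)
  have init: "A 0 = a" "B 0 = b" "C 0 = c" "D 0 = d"
    by (simp_all add: A_def B_def C_def D_def G_def)
  have dt: "A n * D n - B n * C n = 1" for n
    using discrete_matrix_groupD(1)[OF S G_S[of n]] unfolding Gn by simp
  then have AD: "A n * D n = 1 + p n" for n by (simp add: p_def algebra_simps)
  have uv: "u * v = 1" using discrete_matrix_groupD(1)[OF S f] by simp
  then have uv0: "u \<noteq> 0" "v \<noteq> 0" by auto
  have G_Suc: "G (Suc n) = mat2 (A n) (B n) (C n) (D n) ** mat2 u 0 0 v ** mat2 (D n) (- B n) (- C n) (A n)" for n
    using matrix_inv_mat2[OF dt[of n]] Gn[of n] by (simp add: G_def)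
  have "mat2 (A (Suc n)) (B (Suc n)) (C (Suc n)) (D (Suc n)) =
      mat2 (A n * D n * u - B n * C n * v) (A n * B n * (v - u))
        (C n * D n * (u - v)) (A n * D n * v - B n * C n * u)" for n
    unfolding Gn[of "Suc n", symmetric] G_Suc by (simp add: algebra_simps)
  then have rec: "A (Suc n) = (1 + p n) * u - p n * v" "B (Suc n) = A n * B n * (v - u)"
      "C (Suc n) = C n * D n * (u - v)" "D (Suc n) = (1 + p n) * v - p n * u" for n
    by (simp_all add: AD flip: p_def)
  have p_rec: "p (Suc n) = - (p n * (1 + p n) * (u - v)\<^sup>2)" for n
  proof -
    have "p (Suc n) = B n * C n * (A n * D n) * ((v - u) * (u - v))"
      unfolding p_def[of "Suc n"] rec by simp
    then show ?thesis unfolding AD by (simp add: p_def power2_eq_square algebra_simps)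
  qed
  have q: "0 \<le> q" "q < 1" using small by (auto simp: q_def)
  have p_bd: "cmod (p n) \<le> q ^ n * cmod (b * c)" for n
  proof (induction n)
    case 0 then show ?case by (simp add: p_def init)
  next
    case (Suc n)
    have "q ^ n * cmod (b * c) \<le> 1 * cmod (b * c)"
      using q by (intro mult_right_mono power_le_one) auto
    then have "cmod (p n) \<le> cmod (b * c)" using Suc by simp
    then have "cmod (1 + p n) \<le> 1 + cmod (b * c)"
      using norm_triangle_ineq[of 1 "p n"] by simp
    then have "cmod ((u - v)\<^sup>2) * cmod (1 + p n) \<le> q"
      unfolding q_def by (intro mult_left_mono) auto
    then have "(cmod ((u - v)\<^sup>2) * cmod (1 + p n)) * cmod (p n) \<le> q * (q ^ n * cmod (b * c))"
      using Suc q by (intro mult_mono) auto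
    then show ?case unfolding p_rec by (simp add: norm_mult mult_ac)
  qed
  have p_lim: "p \<longlonglongrightarrow> 0"
  proof (rule Lim_null_comparison[OF always_eventually[OF allI[OF p_bd]]])
    have "(\<lambda>n. q ^ n) \<longlonglongrightarrow> 0" using q by (intro LIMSEQ_power_zero) auto
    then show "(\<lambda>n. q ^ n * cmod (b * c)) \<longlonglongrightarrow> 0" by (rule tendsto_mult_left_zero)
  qed
  have "(\<lambda>n. A (Suc n)) \<longlonglongrightarrow> (1 + 0) * u - 0 * v" "(\<lambda>n. D (Suc n)) \<longlonglongrightarrow> (1 + 0) * v - 0 * u"
    unfolding rec by (intro tendsto_intros p_lim)+
  then have A_lim: "A \<longlonglongrightarrow> u" and D_lim: "D \<longlonglongrightarrow> v"
    by (simp_all add: LIMSEQ_imp_Suc)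
  have "cmod ((u - v)\<^sup>2) \<le> q"
    unfolding q_def by (simp add: algebra_simps mult_left_le)
  then have norm_sq: "cmod ((u - v)\<^sup>2) < 1" using q by simp
  then have norm_uv: "cmod (u - v) < 1" by (simp add: norm_power abs_square_less_1)
  have "(\<lambda>n. B n * v ^ n) \<longlonglongrightarrow> 0"
  proof (rule tendsto_0_of_ratio)
    show "B (Suc n) * v ^ Suc n = (A n * (v - u) * v) * (B n * v ^ n)" for n by (simp add: rec)
    have "(\<lambda>n. A n * (v - u) * v) \<longlonglongrightarrow> u * (v - u) * v" by (intro tendsto_intros A_lim)
    moreover have "u * (v - u) * v = v - u" using uv by (simp add: mult.commute mult.left_commute)
    ultimately show "(\<lambda>n. A n * (v - u) * v) \<longlonglongrightarrow> v - u" by simp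
    show "cmod (v - u) < 1" using norm_uv by (simp add: norm_minus_commute)
  qed
  moreover have "(\<lambda>n. C n * u ^ n) \<longlonglongrightarrow> 0"
  proof (rule tendsto_0_of_ratio)
    show "C (Suc n) * u ^ Suc n = (D n * (u - v) * u) * (C n * u ^ n)" for n by (simp add: rec)
    have "(\<lambda>n. D n * (u - v) * u) \<longlonglongrightarrow> v * (u - v) * u" by (intro tendsto_intros D_lim)
    moreover have "v * (u - v) * u = u - v" using uv by (simp add: mult.commute mult.left_commute)
    ultimately show "(\<lambda>n. D n * (u - v) * u) \<longlonglongrightarrow> u - v" by simp
    show "cmod (u - v) < 1" by (rule norm_uv)
  qed
  ultimately have "(\<lambda>n. mat2 (A (2 * n)) (B (2 * n) * v ^ (2 * n)) (C (2 * n) * u ^ (2 * n)) (D (2 * n)))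
      \<longlonglongrightarrow> mat2 u 0 0 v"
    using A_lim D_lim
    by (intro tendsto_mat2; elim filterlim_compose)
       (auto intro!: filterlim_subseq simp: strict_mono_def)
  moreover have "mat2 (A (2 * n)) (B (2 * n) * v ^ (2 * n)) (C (2 * n) * u ^ (2 * n)) (D (2 * n)) \<in> S" for n
  proof -
    have one: "mat2 1 0 0 1 \<in> S"
      using discrete_matrix_groupD(3)[OF S f discrete_matrix_groupD(2)[OF S f]] uv
      by (simp add: mult.commute)
    have pw: "mat2 (u ^ n) 0 0 (v ^ n) \<in> S"
    proof (induction n)
      case 0 then show ?case using one by simp
    next
      case (Suc n) then show ?case using discrete_matrix_groupD(3)[OF S f Suc] by simp
    qed
    have pw1: "u ^ n * v ^ n = 1" using uv by (metis power_mult_distrib power_one)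
    then have "mat2 (v ^ n) 0 0 (u ^ n) \<in> S"
      using discrete_matrix_groupD(2)[OF S pw] by simp
    then have "mat2 (v ^ n) 0 0 (u ^ n) ** G (2 * n) ** mat2 (u ^ n) 0 0 (v ^ n) \<in> S"
      using pw G_S discrete_matrix_groupD(3)[OF S] by blast
    moreover have "mat2 (v ^ n) 0 0 (u ^ n) ** G (2 * n) ** mat2 (u ^ n) 0 0 (v ^ n) =
        mat2 (A (2 * n)) (B (2 * n) * v ^ (2 * n)) (C (2 * n) * u ^ (2 * n)) (D (2 * n))"
      unfolding Gn mult_2 power_add using pw1 by (simp add: mult_ac)
    ultimately show ?thesis by simp
  qed
  ultimately have "\<forall>\<^sub>F n in sequentially.
      mat2 (A (2 * n)) (B (2 * n) * v ^ (2 * n)) (C (2 * n) * u ^ (2 * n)) (D (2 * n))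
        \<in> {mat2 u 0 0 v, - mat2 u 0 0 v}"
    by (intro discrete_matrix_groupD(4)[OF S] f)
  then obtain n where "B (2 * n) = 0" "C (2 * n) = 0"
    using uv0 by (auto simp: eventually_sequentially)
  \<comment> \<open>A diagonal \<open>g\<^sub>m\<^sub>+\<^sub>1\<close> comes from a diagonal or antidiagonal \<open>g\<^sub>m\<close>; the latter is possible only
      for \<open>m = 0\<close>, as later terms are conjugate to \<open>f\<close>, whose trace is not zero.\<close>
  moreover have "b = 0 \<and> c = 0 \<or> a = 0 \<and> d = 0" if "B m = 0 \<and> C m = 0" for m
    using that
  proof (induction m)
    case 0 then show ?case by (simp add: init)
  next
    case (Suc m)
    then have "A m * B m = 0" "C m * D m = 0" using ne rec by auto
    then consider "B m = 0 \<and> C m = 0" | "A m = 0 \<and> D m = 0" using dt[of m] by auto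
    then show ?case
    proof cases
      case 1 then show ?thesis by (rule Suc.IH)
    next
      case 2
      show ?thesis
      proof (cases m)
        case 0 then show ?thesis using 2 init by simp
      next
        case (Suc k)
        \<comment> \<open>Trace zero gives \<open>v = - u\<close> and \<open>u v = 1\<close>, hence \<open>(u - v)\<^sup>2 = - 4\<close>, against the smallness.\<close>
        have "A m + D m = u + v" unfolding Suc rec by (simp add: algebra_simps)
        then have "v = - u" using 2 by (simp add: add_eq_0_iff)
        then have "(u - v)\<^sup>2 = - 4 * (u * v)" by (simp add: power2_eq_square)
        then have "cmod ((u - v)\<^sup>2) = 4" using uv by simp
        then show ?thesis using norm_sq by simp
      qed
    qed
  qed
  ultimately show ?thesis by blast
qed

section \<open>Ideal points and elementary groups\<close>

text \<open>The point of the Riemann sphere with homogeneous coordinates \<open>x\<close>, at height zero. In these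
  coordinates the action is linear, and its compatibility with products is associativity of
  matrix multiplication.\<close>

definition ideal_point :: "complex^2 \<Rightarrow> (complex \<times> real) option" where
  "ideal_point x = (if x$2 = 0 then None else Some (x$1 / x$2, 0))"

lemma ideal_point_scale: "k \<noteq> 0 \<Longrightarrow> ideal_point (k *s x) = ideal_point x"
  by (simp add: ideal_point_def)

lemma ideal_point_in_closed_H3: "ideal_point x \<in> closed_H3"
  by (auto simp: ideal_point_def closed_H3_def)

lemma poincare_ideal_point:
  assumes "det M = 1" "x \<noteq> 0"
  shows "poincare M (ideal_point x) = ideal_point (M *v x)"
proof -
  obtain a b c d where M: "M = mat2 a b c d" by (rule mat2_cases)
  have dt: "a * d - b * c = 1" using assms(1) M by simp
  have Mx: "(M *v x)$1 = a * x$1 + b * x$2" "(M *v x)$2 = c * x$1 + d * x$2"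
    by (simp_all add: M matrix_vector_mult_def sum_2)
  show ?thesis
  proof (cases "x$2 = 0")
    case True
    then have "x$1 \<noteq> 0" using assms(2) by (auto simp: vec_eq_iff forall_2)
    then show ?thesis using True by (simp add: ideal_point_def Mx, simp add: M)
  next
    case False
    define z where "z = x$1 / x$2"
    have e: "a * x$1 + b * x$2 = (a * z + b) * x$2" "c * x$1 + d * x$2 = (c * z + d) * x$2"
      using False by (simp_all add: z_def field_simps)
    have "p * cnj q / complex_of_real ((cmod q)\<^sup>2) = p / q" for p q
      by (cases "q = 0") (simp_all add: complex_norm_square del: of_real_power)
    from this[of "a * z + b" "c * z + d"]
    show ?thesis
      using False by (simp add: ideal_point_def Mx e del: complex_cnj_add complex_cnj_mult flip: z_def) (simp add: M Let_def del: complex_cnj_add complex_cnj_mult)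
  qed
qed

lemma matrix_vector_nonzero:
  fixes M :: "complex^2^2"
  assumes "det M = 1" "x \<noteq> 0" shows "M *v x \<noteq> 0"
  by (metis assms matrix_inv_cancel(2) matrix_vector_mul_assoc matrix_vector_mul_lid matrix_vector_mult_0_right)

text \<open>The matrices that map the finite set \<open>K\<close> of ideal points onto itself form a group: it is the
  equality of image and set, rather than an inclusion, that passes to inverses at once.\<close>

lemma elementary_of_invariant_points:
  assumes det: "det X = 1" "det Y = 1"
    and V: "finite V" "V \<noteq> {}" "0 \<notin> V"
    and X: "(\<lambda>x. ideal_point (X *v x)) ` V = ideal_point ` V"
    and Y: "(\<lambda>x. ideal_point (Y *v x)) ` V = ideal_point ` V"
  shows "elementary (generate PSL2 {psl X, psl Y})"
proof -
  define K where "K = ideal_point ` V"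
  have comp: "poincare (M ** N) ` K = poincare M ` poincare N ` K" if "det M = 1" "det N = 1" for M N
    unfolding K_def image_image
  proof (intro image_cong refl)
    fix x assume "x \<in> V"
    then have "x \<noteq> 0" using V(3) by auto
    then show "poincare (M ** N) (ideal_point x) = poincare M (poincare N (ideal_point x))"
      using that by (simp add: poincare_ideal_point det_mul matrix_vector_nonzero matrix_vector_mul_assoc)
  qed
  have image: "poincare M ` K = (\<lambda>x. ideal_point (M *v x)) ` V" if "det M = 1" for M
    unfolding K_def image_image
    by (intro image_cong refl poincare_ideal_point) (use that V(3) in auto)
  have one: "poincare (mat 1) ` K = K"
    using image[of "mat 1"] by (simp add: K_def)
  have "poincare X ` K = K" "poincare Y ` K = K"
    using X Y det by (simp_all add: image) (simp_all add: K_def)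
  then have gens: "\<exists>M. h = psl M \<and> det M = 1 \<and> poincare M ` K = K" if "h \<in> {psl X, psl Y}" for h
    using that det by (elim insertE emptyE) auto
  have elts: "\<exists>M. C = psl M \<and> det M = 1 \<and> poincare M ` K = K" if "C \<in> generate PSL2 {psl X, psl Y}" for C
    using that
  proof induction
    case one
    show ?case by (intro exI[of _ "mat 1"]) (simp add: \<open>poincare (mat 1) ` K = K\<close> psl_one)
  next
    case (incl h)
    then show ?case by (rule gens)
  next
    case (inv h)
    obtain M where M: "h = psl M" "det M = 1" "poincare M ` K = K"
      using gens[OF inv(1)] by (elim exE conjE)
    have "poincare (matrix_inv M) ` K = poincare (matrix_inv M) ` poincare M ` K"
      by (simp only: M(3))
    also have "\<dots> = K"
      using comp[OF det_matrix_inv[OF M(2)] M(2)] one by (simp add: matrix_inv_cancel[OF M(2)])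
    finally show ?case
      using M by (intro exI[of _ "matrix_inv M"]) (simp add: psl_inv det_matrix_inv)
  next
    case (eng h1 h2)
    from eng.IH(1) obtain M where M: "h1 = psl M" "det M = 1" "poincare M ` K = K" by (elim exE conjE)
    from eng.IH(2) obtain N where N: "h2 = psl N" "det N = 1" "poincare N ` K = K" by (elim exE conjE)
    have "poincare (M ** N) ` K = K"
      unfolding comp[OF M(2) N(2)] N(3) M(3) ..
    then show ?case
      using M(1,2) N(1,2) by (intro exI[of _ "M ** N"]) (simp add: det_mul psl_mult)
  qed
  have inv: "poincare M ` K = K" if "M \<in> \<Union>(generate PSL2 {psl X, psl Y})" for M
  proof -
    from that obtain C where C: "C \<in> generate PSL2 {psl X, psl Y}" "M \<in> C" by blast
    then obtain N where N: "C = psl N" "poincare N ` K = K"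
      using elts[OF C(1)] by (elim exE conjE)
    then have "M = N \<or> M = - N" using C(2) by (simp add: psl_eq)
    then show ?thesis using N(2) by (auto simp: poincare_minus)
  qed
  obtain x where x: "x \<in> V" using V(2) by blast
  have "psl_orbit (generate PSL2 {psl X, psl Y}) (ideal_point x) \<subseteq> K"
  proof
    fix y assume "y \<in> psl_orbit (generate PSL2 {psl X, psl Y}) (ideal_point x)"
    then obtain M where M: "M \<in> \<Union>(generate PSL2 {psl X, psl Y})" "y = poincare M (ideal_point x)"
      unfolding psl_orbit_def by blast
    have "ideal_point x \<in> K" using x by (simp add: K_def)
    then have "y \<in> poincare M ` K" unfolding M(2) by (rule imageI)
    then show "y \<in> K" using inv[OF M(1)] by simp
  qed
  moreover have "finite K" using V(1) by (simp add: K_def)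
  ultimately show ?thesis
    unfolding elementary_def using ideal_point_in_closed_H3 finite_subset by blast
qed

lemma elementary_of_conjugate_triangular:
  assumes det: "det X = 1" "det Y = 1" "det P = 1"
    and X: "conjugate P X = mat2 a b 0 d" and Y: "conjugate P Y = mat2 a' b' 0 d'"
  shows "elementary (generate PSL2 {psl X, psl Y})"
proof -
  define e :: "complex^2" where "e = vector [1, 0]"
  have e0: "e \<noteq> 0" by (simp add: e_def vec_eq_iff forall_2)
  have fix_pt: "ideal_point (M *v (P *v e)) = ideal_point (P *v e)"
    if "det M = 1" "conjugate P M = mat2 k l 0 m" for M k l m
  proof -
    have "k * m = 1" using det_conjugate[OF det(3), of M] that by simp
    then have "k \<noteq> 0" by auto
    have "mat2 k l 0 m *v e = k *s e"
      by (simp add: e_def vec_eq_iff forall_2 matrix_vector_mult_def sum_2)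
    then have "M *v (P *v e) = k *s (P *v e)"
      using conjugate_cancel[OF det(3), of M] that
      by (metis matrix_vector_mul_assoc vector_scalar_commute)
    then show ?thesis using \<open>k \<noteq> 0\<close> by (simp add: ideal_point_scale)
  qed
  show ?thesis
    by (rule elementary_of_invariant_points[of _ _ "{P *v e}"])
       (use det X Y fix_pt matrix_vector_nonzero[OF det(3) e0] in auto)
qed

lemma elementary_of_conjugate_monomial:
  assumes det: "det X = 1" "det Y = 1" "det P = 1"
    and X: "conjugate P X = mat2 u 0 0 v" and Y: "conjugate P Y = mat2 a b c d"
    and abcd: "b = 0 \<and> c = 0 \<or> a = 0 \<and> d = 0"
  shows "elementary (generate PSL2 {psl X, psl Y})"
proof -
  define e1 e2 :: "complex^2" where "e1 = vector [1, 0]" and "e2 = vector [0, 1]"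
  have e0: "e1 \<noteq> 0" "e2 \<noteq> 0" by (simp_all add: e1_def e2_def vec_eq_iff forall_2)
  have act: "ideal_point (M *v (P *v x)) = ideal_point (P *v y)"
    if "conjugate P M *v x = k *s y" "k \<noteq> 0" for M x y k
  proof -
    have "M *v (P *v x) = k *s (P *v y)"
      using conjugate_cancel[OF det(3), of M] that
      by (metis matrix_vector_mul_assoc vector_scalar_commute)
    then show ?thesis using that(2) by (simp add: ideal_point_scale)
  qed
  have uv: "u * v = 1" and ad: "a * d - b * c = 1"
    using det_conjugate[OF det(3), of X] det_conjugate[OF det(3), of Y] X Y det by simp_all
  have mv: "mat2 a b c d *v e1 = vector [a, c]" "mat2 a b c d *v e2 = vector [b, d]" for a b c d
    by (simp_all add: e1_def e2_def vec_eq_iff forall_2 matrix_vector_mult_def sum_2)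
  have sc: "vector [k, 0] = k *s e1" "vector [0, k] = k *s e2" for k
    by (simp_all add: e1_def e2_def vec_eq_iff forall_2)
  have "u \<noteq> 0" "v \<noteq> 0" using uv by auto
  then have X12: "ideal_point (X *v (P *v e1)) = ideal_point (P *v e1)"
      "ideal_point (X *v (P *v e2)) = ideal_point (P *v e2)"
    using act[of X e1 u e1] act[of X e2 v e2] by (simp_all add: X mv sc)
  have Y12: "ideal_point (Y *v (P *v e1)) = ideal_point (P *v e1) \<and>
      ideal_point (Y *v (P *v e2)) = ideal_point (P *v e2) \<or>
      ideal_point (Y *v (P *v e1)) = ideal_point (P *v e2) \<and>
      ideal_point (Y *v (P *v e2)) = ideal_point (P *v e1)"
    using abcd
  proof (elim disjE conjE)
    assume "b = 0" "c = 0"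
    moreover from this have "a \<noteq> 0" "d \<noteq> 0" using ad by auto
    ultimately show ?thesis using act[of Y e1 a e1] act[of Y e2 d e2] by (simp add: Y mv sc)
  next
    assume "a = 0" "d = 0"
    moreover from this have "b \<noteq> 0" "c \<noteq> 0" using ad by auto
    ultimately show ?thesis using act[of Y e1 c e2] act[of Y e2 b e1] by (simp add: Y mv sc)
  qed
  show ?thesis
  proof (rule elementary_of_invariant_points[OF det(1,2)])
    show "(\<lambda>x. ideal_point (X *v x)) ` {P *v e1, P *v e2} = ideal_point ` {P *v e1, P *v e2}"
      by (simp add: X12)
    show "(\<lambda>x. ideal_point (Y *v x)) ` {P *v e1, P *v e2} = ideal_point ` {P *v e1, P *v e2}"
      using Y12 by (elim disjE conjE) (simp_all add: insert_commute)
    show "0 \<notin> {P *v e1, P *v e2}"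
      using matrix_vector_nonzero[OF det(3)] e0 by (metis insertE singletonD)
  qed simp_all
qed

section \<open>The inequality\<close>

text \<open>A fixed point of the Moebius transformation is moved to \<open>\<infinity>\<close>; if the eigenvalues are distinct,
  a translation then moves the second fixed point to \<open>0\<close>.\<close>

lemma triangularizable:
  assumes "det X = 1"
  obtains P u w v where "det P = 1" "conjugate P X = mat2 u w 0 v" "u * v = 1" "u = v \<or> w = 0"
proof -
  obtain p q r s where X: "X = mat2 p q r s" by (rule mat2_cases)
  have tri: "\<exists>P u w v. det P = 1 \<and> conjugate P X = mat2 u w 0 v"
  proof (cases "r = 0")
    case True
    then have "conjugate (mat 1) X = mat2 p q 0 s"
      by (simp add: X conjugate_def mat2_one)
    then show ?thesis using det_I by blast
  next
    case False
    define z where "z = (p - s + csqrt ((s - p)\<^sup>2 + 4 * r * q)) / (2 * r)"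
    have "(2 * r * z - (p - s))\<^sup>2 = (s - p)\<^sup>2 + 4 * r * q"
      using False by (simp add: z_def)
    then have "4 * r * (r * z\<^sup>2 + (s - p) * z - q) = 0"
      by (simp add: power2_eq_square algebra_simps)
    then have z: "r * z\<^sup>2 + (s - p) * z - q = 0" using False by simp
    \<comment> \<open>\<open>z\<close> is a fixed point of the Moebius transformation, so \<open>(z, 1)\<close> is an eigenvector.\<close>
    have "conjugate (mat2 z (- 1) 1 0) X = mat2 (r * z + s) (- r) (r * z\<^sup>2 + (s - p) * z - q) (p - r * z)"
      by (simp add: X conjugate_def power2_eq_square algebra_simps)
    then show ?thesis using z by (intro exI[of _ "mat2 z (- 1) 1 0"]) auto
  qed
  then obtain P u w v where P: "det P = 1" "conjugate P X = mat2 u w 0 v" by blast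
  have uv: "u * v = 1" using det_conjugate[OF P(1), of X] P(2) assms by simp
  show thesis
  proof (cases "u = v")
    case True then show thesis using that P uv by blast
  next
    case False
    \<comment> \<open>\<open>(t, 1)\<close> is an eigenvector of the triangular matrix for the eigenvalue \<open>v\<close>.\<close>
    define t where "t = w / (v - u)"
    have "conjugate (mat2 1 t 0 1) (mat2 u w 0 v) = mat2 u (u * t + w - t * v) 0 v"
      by (simp add: conjugate_def algebra_simps)
    moreover have "u * t + w - t * v = 0"
      using False by (simp add: t_def field_simps)
    ultimately have "conjugate (P ** mat2 1 t 0 1) X = mat2 u 0 0 v"
      using P by (simp add: conjugate_comp)
    then show thesis using that uv P(1) by (metis det_mul mat2_det mult_1 mult_zero_right diff_zero)
  qed
qed

text \<open>Joergensen's inequality. Each normal form of \<open>X\<close> yields an invariant set of at most two ideal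
  points as soon as \<open>J < 1\<close>.\<close>

theorem jorgensen_inequality:
  assumes XY: "X \<in> carrier PSL2" "Y \<in> carrier PSL2"
    and disc: "discrete_in_PSL2 (generate PSL2 {X, Y})"
    and nonel: "\<not> elementary (generate PSL2 {X, Y})"
  shows "1 \<le> jorgensen X Y"
proof (rule ccontr)
  assume "\<not> 1 \<le> jorgensen X Y"
  obtain M N where M: "det M = 1" "X = psl M" and N: "det N = 1" "Y = psl N"
    using XY psl_cases by metis
  define S where "S = \<Union>(generate PSL2 {X, Y})"
  have "subgroup (generate PSL2 {X, Y}) PSL2"
    using XY by (intro group.generate_is_subgroup[OF group_PSL2]) auto
  then have S: "discrete_matrix_group S"
    unfolding S_def using disc by (rule discrete_matrix_group_Union)
  have "{X, Y} \<subseteq> generate PSL2 {X, Y}" by (auto intro: generate.incl)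
  then have MN: "M \<in> S" "N \<in> S" unfolding S_def M N by (auto simp: psl_eq)
  obtain P u w v where P: "det P = 1" "conjugate P M = mat2 u w 0 v" "u * v = 1" "u = v \<or> w = 0"
    using triangularizable[OF M(1)] .
  obtain a b c d where N': "conjugate P N = mat2 a b c d" by (rule mat2_cases)
  have ad: "a * d - b * c = 1" using det_conjugate[OF P(1), of N] N(1) N' by simp
  have S': "discrete_matrix_group (conjugate P ` S)"
    using S P(1) by (rule discrete_matrix_group_conjugate)
  have f: "mat2 u w 0 v \<in> conjugate P ` S" and g: "mat2 a b c d \<in> conjugate P ` S"
    using MN P(2) N' by (metis imageI)+
  have "jorgensen X Y = jorgensen_SL2 (mat2 u w 0 v) (mat2 a b c d)"
    using jorgensen_psl[of M N] jorgensen_SL2_conjugate[OF P(1) M(1) N(1)] M N P(2) N'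
    by (simp add: SL2_def)
  also have "\<dots> = cmod ((u - v)\<^sup>2) + cmod (w\<^sup>2 * c\<^sup>2 - (u - v) * (b * c * (u - v) - w * c * (a - d)))"
    using P(3) ad by (rule jorgensen_SL2_triangular)
  finally have J: "cmod ((u - v)\<^sup>2) + cmod (w\<^sup>2 * c\<^sup>2 - (u - v) * (b * c * (u - v) - w * c * (a - d))) < 1"
    using \<open>\<not> 1 \<le> jorgensen X Y\<close> by simp
  consider "u \<noteq> v" "w = 0" | "u = v" "w \<noteq> 0" | "u = v" "w = 0" using P(4) by blast
  then have "elementary (generate PSL2 {psl M, psl N})"
  proof cases
    case 1
    have "w\<^sup>2 * c\<^sup>2 - (u - v) * (b * c * (u - v) - w * c * (a - d)) = - ((u - v)\<^sup>2 * (b * c))"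
      using 1(2) by (simp add: power2_eq_square)
    then have "cmod ((u - v)\<^sup>2) * (1 + cmod (b * c)) < 1"
      using J by (simp only: norm_minus_cancel norm_mult distrib_left mult_1_right)
    then have "b = 0 \<and> c = 0 \<or> a = 0 \<and> d = 0"
      using jorgensen_diagonal[OF S' _ 1(1) g] f 1(2) by simp
    then show ?thesis
      using elementary_of_conjugate_monomial[OF M(1) N(1) P(1) _ N'] P(2) 1(2) by simp
  next
    case 2
    have "(cmod (w * c))\<^sup>2 < 1" using J 2(1) by (simp add: norm_mult norm_power power_mult_distrib)
    then have "cmod (w * c) < 1" by (simp add: abs_square_less_1)
    then have "c = 0" using jorgensen_parabolic[OF S' _ 2(2) g] f 2(1) by simp
    then show ?thesis
      using elementary_of_conjugate_triangular[OF M(1) N(1) P(1) P(2)] N' by simp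
  next
    case 3
    \<comment> \<open>\<open>M\<close> is central, so any eigenvector of \<open>N\<close> gives a common fixed point.\<close>
    have "M = P ** mat2 u 0 0 u ** matrix_inv P"
      using P(2) 3 conjugate_cancel[OF P(1), of M]
      by (metis P(1) matrix_inv_cancel(1) matrix_mul_assoc matrix_mul_rid)
    obtain Q k l m where Q: "det Q = 1" "conjugate Q N = mat2 k l 0 m"
      using triangularizable[OF N(1)] by metis
    have "mat2 u 0 0 u ** R = R ** mat2 u 0 0 u" for R
      by (cases R rule: mat2_cases) (simp add: mult.commute)
    then have "M = mat2 u 0 0 u"
      using \<open>M = _\<close> by (metis P(1) matrix_inv_cancel(1) matrix_mul_assoc matrix_mul_rid)
    then have "conjugate Q M = mat2 u 0 0 u"
      using \<open>\<And>R. mat2 u 0 0 u ** R = R ** mat2 u 0 0 u\<close>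
      by (metis Q(1) conjugate_def matrix_inv_cancel(2) matrix_mul_assoc matrix_mul_rid)
    then show ?thesis
      using elementary_of_conjugate_triangular[OF M(1) N(1) Q(1) _ Q(2)] by blast
  qed
  then show False using nonel M N by simp
qed

theorem proposition6p1:
  fixes \<Gamma> :: "(complex^2^2) set set"
  assumes "kleinian \<Gamma>" and "psl (mat2 1 1 0 1) \<in> \<Gamma>"
  shows
    "(1 \<le> gen_jorgensen_number \<Gamma> \<and>
      gen_jorgensen_number \<Gamma> \<le>
        Inf {ereal ((cmod c)\<^sup>2) | a b c d.
          a * d - b * c = 1 \<and> psl (mat2 a b c d) \<in> \<Gamma> \<and> c \<noteq> 0 \<and>
          \<not> elementary (generate PSL2 {psl (mat2 1 1 0 1), psl (mat2 a b c d)})}) \<and>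
     (\<not> elementary \<Gamma> \<and> (\<exists>B\<in>carrier PSL2. generate PSL2 {psl (mat2 1 1 0 1), B} = \<Gamma>) \<longrightarrow>
      1 \<le> jorgensen_number \<Gamma> \<and>
      jorgensen_number \<Gamma> \<le>
        Inf {ereal ((cmod c)\<^sup>2) | a b c d.
          a * d - b * c = 1 \<and> psl (mat2 a b c d) \<in> \<Gamma> \<and> c \<noteq> 0 \<and>
          generate PSL2 {psl (mat2 1 1 0 1), psl (mat2 a b c d)} = \<Gamma>})"
proof -
  define A where "A = mat2 1 1 0 1"
  have sub: "subgroup \<Gamma> PSL2" and disc: "discrete_in_PSL2 \<Gamma>"
    using assms(1) by (auto simp: kleinian_def)
  have A: "psl A \<in> \<Gamma>" "psl A \<in> carrier PSL2"
    using assms(2) by (simp_all add: A_def psl_in_carrier)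
  have J: "jorgensen (psl A) (psl (mat2 a b c d)) = (cmod c)\<^sup>2" if "a * d - b * c = 1" for a b c d
    using jorgensen_psl[of A "mat2 a b c d"] jorgensen_SL2_triangular[of 1 1 a d b c 1] that
    by (simp add: A_def SL2_def norm_power)
  have gen_sub: "generate PSL2 {X, Y} \<subseteq> \<Gamma>" if "X \<in> \<Gamma>" "Y \<in> \<Gamma>" for X Y
    using that by (intro group.generate_subgroup_incl[OF group_PSL2 _ sub]) auto
  have disc_sub: "discrete_in_PSL2 H" if "H \<subseteq> \<Gamma>" for H
  proof -
    have "subtopology PSL2_topology H = subtopology (subtopology PSL2_topology \<Gamma>) H"
      using that by (simp add: subtopology_subtopology Int_absorb1)
    also have "\<dots> = discrete_topology H"
      using disc that by (simp add: discrete_in_PSL2_def subtopology_discrete_topology Int_absorb1)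
    finally show ?thesis by (simp add: discrete_in_PSL2_def)
  qed
  have "1 \<le> gen_jorgensen_number \<Gamma>"
    unfolding gen_jorgensen_number_def
    by (rule Inf_greatest) (auto intro: jorgensen_inequality)
  moreover have "gen_jorgensen_number \<Gamma> \<le>
        Inf {ereal ((cmod c)\<^sup>2) | a b c d.
          a * d - b * c = 1 \<and> psl (mat2 a b c d) \<in> \<Gamma> \<and> c \<noteq> 0 \<and>
          \<not> elementary (generate PSL2 {psl A, psl (mat2 a b c d)})}"
  proof (rule Inf_greatest, elim CollectE exE conjE)
    fix z a b c d
    assume z: "z = ereal ((cmod c)\<^sup>2)" and h: "a * d - b * c = 1" "psl (mat2 a b c d) \<in> \<Gamma>"
      "\<not> elementary (generate PSL2 {psl A, psl (mat2 a b c d)})"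
    have "gen_jorgensen_number \<Gamma> \<le> ereal (jorgensen (psl A) (psl (mat2 a b c d)))"
      unfolding gen_jorgensen_number_def
      by (rule Inf_lower) (use A h gen_sub disc_sub in \<open>auto simp: psl_in_carrier intro!: exI\<close>)
    then show "gen_jorgensen_number \<Gamma> \<le> z" using z h(1) by (simp add: J)
  qed
  moreover have "1 \<le> jorgensen_number \<Gamma>" if "\<not> elementary \<Gamma>"
    unfolding jorgensen_number_def
    by (rule Inf_greatest) (use that disc in \<open>auto intro: jorgensen_inequality\<close>)
  moreover have "jorgensen_number \<Gamma> \<le>
        Inf {ereal ((cmod c)\<^sup>2) | a b c d.
          a * d - b * c = 1 \<and> psl (mat2 a b c d) \<in> \<Gamma> \<and> c \<noteq> 0 \<and>
          generate PSL2 {psl A, psl (mat2 a b c d)} = \<Gamma>}"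
  proof (rule Inf_greatest, elim CollectE exE conjE)
    fix z a b c d
    assume z: "z = ereal ((cmod c)\<^sup>2)" and h: "a * d - b * c = 1" "generate PSL2 {psl A, psl (mat2 a b c d)} = \<Gamma>"
    have "jorgensen_number \<Gamma> \<le> ereal (jorgensen (psl A) (psl (mat2 a b c d)))"
      unfolding jorgensen_number_def
      by (rule Inf_lower) (use A h in \<open>auto simp: psl_in_carrier intro!: exI\<close>)
    then show "jorgensen_number \<Gamma> \<le> z" using z h(1) by (simp add: J)
  qed
  ultimately show ?thesis unfolding A_def by blast
qed

end
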